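(* Let $G$ be a connected simple graph with $n\ge 2$ vertices and $m$ edges, with maximum vertex degree $\Delta(G)$, minimum vertex degree $\delta(G)$, and let $q(G)$ be the largest signless Laplacian eigenvalue of $G$. Then $$QE(G)\le \frac{2m}{n(n-1)}+n-2+\sqrt{(n-1)\Big(2m+\frac{n}{4}(\Delta(G)-\delta(G))^2-\Big(q(G)-\frac{2m}{n}\Big)^2\Big)},$$ with equality if and only if $G\cong K_n$.
   Context: The signless Laplacian matrix of $G$ is $Q(G)=D(G)+A(G)$ ($A(G)$ adjacency matrix, $D(G)$ diagonal degree matrix), with eigenvalues $q_1\ge\dots\ge q_n\ge0$ and $q(G)=q_1$. The signless Laplacian energy is $QE(G)=\sum_{i=1}^n\big|q_i-\frac{2m}{n}\big|$. $K_n$ is the complete graph on $n$ vertices. *)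

theory Defs
  imports
    Jordan_Normal_Form.Char_Poly
    Graph_Theory.Graph_Theory
begin

text \<open>
  Simple graphs are the finite, loopfree, symmetric digraphs without multiple arcs of the locale
  \<^locale>\<open>graph\<close>. Each undirected edge is a pair of opposite arcs, so edges are counted by their
  end point sets, and the degree of a vertex is its out-degree.
\<close>

definition num_edges :: "('a, 'b) pre_digraph \<Rightarrow> nat" where
  "num_edges G = card ((\<lambda>e. {tail G e, head G e}) ` arcs G)"

definition max_degree :: "('a, 'b) pre_digraph \<Rightarrow> nat" where
  "max_degree G = Max (out_degree G ` verts G)"

definition min_degree :: "('a, 'b) pre_digraph \<Rightarrow> nat" where
  "min_degree G = Min (out_degree G ` verts G)"

text \<open>
  Matrices are indexed by natural numbers, so the matrices of \<open>G\<close> depend on an enumeration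
  \<open>v 0, \<dots>, v (n - 1)\<close> of its \<open>n\<close> vertices. A different enumeration gives a matrix that
  is similar by a permutation.
\<close>

definition adjacency_mat :: "('a, 'b) pre_digraph \<Rightarrow> (nat \<Rightarrow> 'a) \<Rightarrow> real mat" where
  "adjacency_mat G v = mat (card (verts G)) (card (verts G))
     (\<lambda>(i, j). if v i \<rightarrow>\<^bsub>G\<^esub> v j then 1 else 0)"

definition degree_mat :: "('a, 'b) pre_digraph \<Rightarrow> (nat \<Rightarrow> 'a) \<Rightarrow> real mat" where
  "degree_mat G v = mat (card (verts G)) (card (verts G))
     (\<lambda>(i, j). if i = j then real (out_degree G (v i)) else 0)"

definition signless_laplacian_mat :: "('a, 'b) pre_digraph \<Rightarrow> (nat \<Rightarrow> 'a) \<Rightarrow> real mat" where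
  "signless_laplacian_mat G v = degree_mat G v + adjacency_mat G v"

text \<open>
  The eigenvalues with their algebraic multiplicities. For a graph the matrix is real symmetric, so
  its characteristic polynomial splits over the reals and these are all \<open>n\<close> eigenvalues.
\<close>

definition signless_laplacian_eigenvalues ::
    "('a, 'b) pre_digraph \<Rightarrow> (nat \<Rightarrow> 'a) \<Rightarrow> real multiset" where
  "signless_laplacian_eigenvalues G v = proots (char_poly (signless_laplacian_mat G v))"

definition largest_signless_laplacian_eigenvalue ::
    "('a, 'b) pre_digraph \<Rightarrow> (nat \<Rightarrow> 'a) \<Rightarrow> real" where
  "largest_signless_laplacian_eigenvalue G v =
     Max (set_mset (signless_laplacian_eigenvalues G v))"

definition signless_laplacian_energy ::
    "('a, 'b) pre_digraph \<Rightarrow> (nat \<Rightarrow> 'a) \<Rightarrow> real" where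
  "signless_laplacian_energy G v =
     (\<Sum>q\<in>#signless_laplacian_eigenvalues G v.
        \<bar>q - 2 * real (num_edges G) / real (card (verts G))\<bar>)"

end

theory Submission
  imports Defs Jordan_Normal_Form.Schur_Decomposition
begin

text \<open>
  Split off the largest eigenvalue \<open>q\<close> and apply the Cauchy--Schwarz inequality to the other
  \<open>n - 1\<close> terms. The sum of all \<open>(q\<^sub>i - 2m/n)\<^sup>2\<close> is \<open>2m\<close> plus the sum of the squared deviations of
  the degrees from their mean \<open>2m/n\<close>, and Popoviciu's inequality bounds the latter by
  \<open>n/4 (\<Delta> - \<delta>)\<^sup>2\<close>. Moreover \<open>q\<close> is at most the maximum of \<open>d u + S u / d u\<close>, where \<open>S u\<close> is the sum of
  the degrees of the neighbours of \<open>u\<close>, and each of these numbers is at most \<open>2m/(n - 1) + n - 2\<close>.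

  In the case of equality the degrees take only the values \<open>\<Delta>\<close> and \<open>\<delta>\<close>, their mean is
  \<open>(\<Delta> + \<delta>)/2\<close>, and \<open>d u + S u / d u = 2m/(n - 1) + n - 2\<close> holds at some vertex \<open>u\<close> and at all its
  neighbours. Under the condition on the degrees this equation forces full degree, so \<open>u\<close> is
  adjacent to all vertices, and then all vertices have full degree.
\<close>

section \<open>Eigenvalues of real symmetric matrices\<close>

definition mat_trace :: "'a :: semiring_0 mat \<Rightarrow> 'a" where
  "mat_trace A = sum_list (diag_mat A)"

lemma mat_trace_eq_sum:
  assumes "A \<in> carrier_mat n n"
  shows "mat_trace A = (\<Sum>i<n. A $$ (i, i))"
  using assms by (auto simp: mat_trace_def diag_mat_def interv_sum_list_conv_sum_set_nat atLeast0LessThan)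

lemma index_mult_mat_sum:
  assumes "A \<in> carrier_mat n n" "B \<in> carrier_mat n n" "i < n" "j < n"
  shows "(A * B) $$ (i, j) = (\<Sum>k<n. A $$ (i, k) * B $$ (k, j))"
  using assms by (auto simp: scalar_prod_def atLeast0LessThan intro!: sum.cong)

lemma index_mult_mat_vec_sum:
  assumes "A \<in> carrier_mat n n" "x \<in> carrier_vec n" "i < n"
  shows "(A *\<^sub>v x) $ i = (\<Sum>j<n. A $$ (i, j) * x $ j)"
  using assms by (auto simp: scalar_prod_def atLeast0LessThan intro!: sum.cong)

lemma mat_trace_mult_comm:
  fixes A B :: "'a :: comm_semiring_0 mat"
  assumes "A \<in> carrier_mat n n" "B \<in> carrier_mat n n"
  shows "mat_trace (A * B) = mat_trace (B * A)"
proof -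
  have "mat_trace (A * B) = (\<Sum>i<n. \<Sum>k<n. A $$ (i, k) * B $$ (k, i))"
    using assms by (subst mat_trace_eq_sum[of _ n]) (auto simp: index_mult_mat_sum[OF assms] simp del: index_mult_mat)
  also have "\<dots> = (\<Sum>k<n. \<Sum>i<n. B $$ (k, i) * A $$ (i, k))"
    by (subst sum.swap) (simp add: mult.commute)
  also have "\<dots> = mat_trace (B * A)"
    using assms by (subst mat_trace_eq_sum[of _ n]) (auto simp: index_mult_mat_sum[OF assms(2,1)] simp del: index_mult_mat)
  finally show ?thesis .
qed

lemma mat_trace_similar:
  fixes A B :: "'a :: comm_ring_1 mat"
  assumes "similar_mat_wit A B P Q"
  shows "mat_trace A = mat_trace B"
proof -
  define n where "n = dim_row A"
  note D = similar_mat_witD[OF n_def assms]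
  have "mat_trace A = mat_trace (P * (B * Q))"
    using D by (simp add: assoc_mult_mat[of _ n n _ n _ n])
  also have "\<dots> = mat_trace (B * Q * P)"
    using D by (intro mat_trace_mult_comm[of _ n]) auto
  also have "B * Q * P = B"
    using D by (simp add: assoc_mult_mat[of _ n n _ n _ n])
  finally show ?thesis .
qed

text \<open>For \<open>k \<noteq> i\<close> one of the factors \<open>B $$ (i, k)\<close> and
  \<open>B $$ (k, i)\<close> lies below the diagonal.\<close>

lemma upper_triangular_square_diag:
  fixes B :: "'a :: comm_ring_1 mat"
  assumes B: "B \<in> carrier_mat n n" and ut: "upper_triangular B" and i: "i < n"
  shows "(B * B) $$ (i, i) = (B $$ (i, i))\<^sup>2"
proof -
  have "(B * B) $$ (i, i) = (\<Sum>k<n. B $$ (i, k) * B $$ (k, i))"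
    by (rule index_mult_mat_sum[OF B B i i])
  also have "\<dots> = (\<Sum>k<n. if k = i then (B $$ (i, i))\<^sup>2 else 0)"
  proof (rule sum.cong[OF refl])
    fix k assume "k \<in> {..<n}"
    then show "B $$ (i, k) * B $$ (k, i) = (if k = i then (B $$ (i, i))\<^sup>2 else 0)"
      using upper_triangularD[OF ut, of k i] upper_triangularD[OF ut, of i k] B i
      by (cases k i rule: linorder_cases) (auto simp: power2_eq_square)
  qed
  finally show ?thesis using i by simp
qed

text \<open>The Hermitian form \<open>s\<close> at an eigenvector is \<open>c\<close> times the
  nonzero squared norm \<open>N\<close>, and symmetry of the real matrix makes \<open>s\<close> its
  own conjugate.\<close>

lemma symmetric_real_mat_eigenvalue_real:
  fixes A :: "real mat"
  assumes A: "A \<in> carrier_mat n n" and sym: "\<And>i j. i < n \<Longrightarrow> j < n \<Longrightarrow> A $$ (i, j) = A $$ (j, i)"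
    and ev: "eigenvalue (map_mat complex_of_real A) c"
  shows "c \<in> \<real>"
proof -
  let ?C = "map_mat complex_of_real A"
  have C: "?C \<in> carrier_mat n n" using A by simp
  from ev obtain x where x: "x \<in> carrier_vec n" "x \<noteq> 0\<^sub>v n" and eq: "?C *\<^sub>v x = c \<cdot>\<^sub>v x"
    using C by (auto simp: eigenvalue_def eigenvector_def)
  have row: "(\<Sum>j<n. complex_of_real (A $$ (i, j)) * x $ j) = c * x $ i" if "i < n" for i
  proof -
    have "(?C *\<^sub>v x) $ i = (\<Sum>j<n. ?C $$ (i, j) * x $ j)"
      by (rule index_mult_mat_vec_sum[OF C x(1) that])
    also have "\<dots> = (\<Sum>j<n. complex_of_real (A $$ (i, j)) * x $ j)"
      using A that by (intro sum.cong) auto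
    finally show ?thesis using that x(1) by (simp add: eq)
  qed
  define N where "N = (\<Sum>i<n. (cmod (x $ i))\<^sup>2)"
  define s where "s = (\<Sum>i<n. \<Sum>j<n. complex_of_real (A $$ (i, j)) * (x $ j * cnj (x $ i)))"
  have "s = (\<Sum>i<n. cnj (x $ i) * (\<Sum>j<n. complex_of_real (A $$ (i, j)) * x $ j))"
    unfolding s_def by (simp add: sum_distrib_left mult_ac)
  also have "\<dots> = (\<Sum>i<n. c * complex_of_real ((cmod (x $ i))\<^sup>2))"
    by (intro sum.cong refl, simp only: complex_norm_square) (simp add: row)
  also have "\<dots> = c * of_real N"
    by (simp add: N_def sum_distrib_left)
  finally have s: "s = c * of_real N" .
  have "cnj s = (\<Sum>i<n. \<Sum>j<n. complex_of_real (A $$ (i, j)) * (x $ i * cnj (x $ j)))"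
    unfolding s_def by (simp add: mult_ac)
  also have "\<dots> = s"
    unfolding s_def by (subst sum.swap) (auto intro!: sum.cong simp: sym)
  finally have "cnj s = s" .
  moreover have "N \<noteq> 0"
  proof
    assume "N = 0"
    then have "\<forall>i<n. x $ i = 0"
      by (auto simp: N_def sum_nonneg_eq_0_iff)
    then have "x = 0\<^sub>v n" using x(1) by (intro eq_vecI) auto
    with x show False by simp
  qed
  ultimately have "cnj c = c" using s by simp
  then show ?thesis by (simp add: Reals_cnj_iff)
qed

text \<open>The splitting over the complex numbers descends to the reals, because all roots are real
  and the embedding of real polynomials is injective.\<close>

lemma symmetric_real_mat_char_poly_factorized:
  fixes A :: "real mat"
  assumes A: "A \<in> carrier_mat n n" and sym: "\<And>i j. i < n \<Longrightarrow> j < n \<Longrightarrow> A $$ (i, j) = A $$ (j, i)"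
  obtains es where "char_poly A = (\<Prod>e\<leftarrow>es. [:- e, 1:])" "length es = n"
proof -
  let ?C = "map_mat complex_of_real A"
  have C: "?C \<in> carrier_mat n n" using A by simp
  from char_poly_factorized[OF C] obtain cs where
    cs: "char_poly ?C = (\<Prod>c\<leftarrow>cs. [:- c, 1:])" "length cs = n" by blast
  have real: "complex_of_real (Re c) = c" if "c \<in> set cs" for c
  proof -
    have "poly (char_poly ?C) c = 0" using that cs(1) linear_poly_root by metis
    then have "eigenvalue ?C c" using eigenvalue_root_char_poly[OF C] by simp
    from symmetric_real_mat_eigenvalue_real[OF A sym this] show ?thesis by simp
  qed
  interpret h: map_poly_inj_idom_hom complex_of_real ..
  have "map_poly complex_of_real (char_poly A) = (\<Prod>c\<leftarrow>cs. [:- c, 1:])"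
    using cs(1) of_real_hom.char_poly_hom[OF A, where 'a=complex] by simp
  also have "map (\<lambda>c. [:- c, 1:]) cs = map (\<lambda>c. map_poly complex_of_real [:- Re c, 1:]) cs"
    by (rule map_cong) (auto simp: real)
  also have "prod_list \<dots> = map_poly complex_of_real (\<Prod>e\<leftarrow>map Re cs. [:- e, 1:])"
    by (simp add: h.hom_prod_list o_def)
  finally have "char_poly A = (\<Prod>e\<leftarrow>map Re cs. [:- e, 1:])"
    by (simp only: h.eq_iff)
  with cs(2) that show ?thesis by (metis length_map)
qed

text \<open>The Schur form \<open>B\<close> carries the roots on its diagonal, so their power sums
  are the traces of \<open>B\<close> and \<open>B * B\<close>, which similarity carries over to
  \<open>A\<close> and \<open>A * A\<close>. Symmetry turns the trace of \<open>A * A\<close> into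
  the sum of all squared entries.\<close>

lemma symmetric_real_mat_proots_char_poly:
  fixes A :: "real mat"
  assumes A: "A \<in> carrier_mat n n" and sym: "\<And>i j. i < n \<Longrightarrow> j < n \<Longrightarrow> A $$ (i, j) = A $$ (j, i)"
  shows "size (proots (char_poly A)) = n"
    and "(\<Sum>e\<in>#proots (char_poly A). e) = (\<Sum>i<n. A $$ (i, i))"
    and "(\<Sum>e\<in>#proots (char_poly A). e\<^sup>2) = (\<Sum>i<n. \<Sum>j<n. (A $$ (i, j))\<^sup>2)"
proof -
  obtain es where es: "char_poly A = (\<Prod>e\<leftarrow>es. [:- e, 1:])" "length es = n"
    using symmetric_real_mat_char_poly_factorized[OF A sym] by blast
  have nz: "(\<Prod>e\<leftarrow>es. [:- e, 1:]) \<noteq> (0 :: real poly)" for es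
    by (auto simp: prod_list_zero_iff)
  have "proots (\<Prod>e\<leftarrow>es. [:- e, 1:]) = mset es"
  proof (induction es)
    case (Cons a es)
    have "proots ([:- a, 1:] * (\<Prod>e\<leftarrow>es. [:- e, 1:])) = proots [:- a, 1:] + proots (\<Prod>e\<leftarrow>es. [:- e, 1:])"
      by (rule proots_mult[OF _ nz]) simp
    then show ?case by (simp add: Cons.IH del: mult_pCons_left)
  qed simp
  then have roots: "proots (char_poly A) = mset es" by (simp add: es)
  obtain B P Q where "schur_decomposition A es = (B, P, Q)" by (metis prod_cases3)
  from schur_decomposition[OF A es(1) this]
  have sim: "similar_mat_wit A B P Q" and ut: "upper_triangular B" and diag: "diag_mat B = es" by auto
  note D = similar_mat_witD2[OF A sim]
  have sim2: "similar_mat_wit (A * A) (B * B) P Q"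
    using similar_mat_wit_pow[OF sim, of 2] D by (simp add: numeral_2_eq_2)
  show "size (proots (char_poly A)) = n" by (simp add: roots es(2))
  have "(\<Sum>e\<in>#proots (char_poly A). e) = mat_trace B"
    by (simp add: roots mat_trace_def diag sum_mset_sum_list)
  also have "\<dots> = (\<Sum>i<n. A $$ (i, i))"
    using mat_trace_similar[OF sim] mat_trace_eq_sum[OF A] by simp
  finally show "(\<Sum>e\<in>#proots (char_poly A). e) = (\<Sum>i<n. A $$ (i, i))" .
  have es_map: "es = map (\<lambda>i. B $$ (i, i)) [0..<n]"
    using D(5) by (simp add: diag[symmetric] diag_mat_def)
  have "(\<Sum>e\<in>#proots (char_poly A). e\<^sup>2) = (\<Sum>e\<leftarrow>es. e\<^sup>2)"
    by (simp add: roots flip: sum_mset_sum_list)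
  also have "\<dots> = (\<Sum>i<n. (B $$ (i, i))\<^sup>2)"
    by (simp add: es_map interv_sum_list_conv_sum_set_nat atLeast0LessThan o_def)
  also have "\<dots> = (\<Sum>i<n. (B * B) $$ (i, i))"
    by (intro sum.cong refl upper_triangular_square_diag[OF D(5) ut, symmetric]) auto
  also have "\<dots> = mat_trace (B * B)"
    using mat_trace_eq_sum[of "B * B" n] D(5) by simp
  also have "\<dots> = mat_trace (A * A)"
    using mat_trace_similar[OF sim2] by simp
  also have "\<dots> = (\<Sum>i<n. (A * A) $$ (i, i))"
    using mat_trace_eq_sum[of "A * A" n] A by simp
  also have "\<dots> = (\<Sum>i<n. \<Sum>j<n. (A $$ (i, j))\<^sup>2)"
    by (intro sum.cong refl) (simp add: index_mult_mat_sum[OF A A] sym power2_eq_square del: index_mult_mat)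
  finally show "(\<Sum>e\<in>#proots (char_poly A). e\<^sup>2) = (\<Sum>i<n. \<Sum>j<n. (A $$ (i, j))\<^sup>2)" .
qed

section \<open>Two inequalities\<close>

text \<open>Cauchy--Schwarz against the constant 1, by induction on the multiset. The step reduces
  to \<open>2 * b * S \<le> k * b\<^sup>2 + T\<close>, which after multiplication by
  \<open>k\<close> follows from \<open>(k * b - S)\<^sup>2 \<ge> 0\<close> and the induction
  hypothesis.\<close>

lemma sum_mset_abs_square_le:
  fixes f :: "'a \<Rightarrow> real"
  shows "(\<Sum>x\<in>#M. \<bar>f x\<bar>)\<^sup>2 \<le> real (size M) * (\<Sum>x\<in>#M. (f x)\<^sup>2)"
proof (induction M)
  case (add a M)
  define k S T b where "k = real (size M)" and "S = (\<Sum>x\<in>#M. \<bar>f x\<bar>)"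
    and "T = (\<Sum>x\<in>#M. (f x)\<^sup>2)" and "b = \<bar>f a\<bar>"
  have ST: "S\<^sup>2 \<le> k * T" using add.IH by (simp add: k_def S_def T_def)
  have "2 * b * S \<le> k * b\<^sup>2 + T"
  proof (cases "k = 0")
    \<comment> \<open>Here \<open>M\<close> is empty, so \<open>S\<close> and \<open>T\<close>
      vanish; the other case cancels a positive factor \<open>k\<close>.\<close>
    case True
    then show ?thesis by (simp add: k_def S_def T_def)
  next
    case False
    then have k: "k > 0" unfolding k_def by linarith
    have "0 \<le> (k * b - S)\<^sup>2" by simp
    also have "\<dots> \<le> k * (k * b\<^sup>2 + T - 2 * b * S)"
      using ST by (simp add: power2_eq_square algebra_simps)
    finally show ?thesis using k by (simp add: zero_le_mult_iff)
  qed
  then have "(b + S)\<^sup>2 \<le> (k + 1) * (b\<^sup>2 + T)"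
    using ST by (simp add: power2_eq_square algebra_simps)
  then show ?case by (simp add: k_def S_def T_def b_def add.commute)
qed simp

text \<open>The two terms on the right are the defect in Popoviciu's inequality on variances.\<close>

lemma popoviciu_defect:
  fixes f :: "'a \<Rightarrow> real" and D \<delta> :: real
  assumes "finite A" "A \<noteq> {}"
  defines "k \<equiv> real (card A)"
  shows "k / 4 * (D - \<delta>)\<^sup>2 - ((\<Sum>x\<in>A. (f x)\<^sup>2) - (\<Sum>x\<in>A. f x)\<^sup>2 / k)
    = k * ((\<Sum>x\<in>A. f x) / k - (D + \<delta>) / 2)\<^sup>2 + (\<Sum>x\<in>A. (D - f x) * (f x - \<delta>))"
proof -
  define s t where "s = (\<Sum>x\<in>A. f x)" and "t = (\<Sum>x\<in>A. (f x)\<^sup>2)"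
  have k: "k \<noteq> 0" using assms by simp
  have "(\<Sum>x\<in>A. (D - f x) * (f x - \<delta>)) = (\<Sum>x\<in>A. (D + \<delta>) * f x - (f x)\<^sup>2 - D * \<delta>)"
    by (intro sum.cong) (auto simp: power2_eq_square algebra_simps)
  also have "\<dots> = (D + \<delta>) * s - t - k * (D * \<delta>)"
    by (simp add: sum_subtractf s_def t_def k_def flip: sum_distrib_left)
  finally have prod: "(\<Sum>x\<in>A. (D - f x) * (f x - \<delta>)) = (D + \<delta>) * s - t - k * (D * \<delta>)" .
  show ?thesis
    unfolding prod s_def[symmetric] t_def[symmetric] using k
    by (simp add: field_simps power2_eq_square)
qed

section \<open>Degrees of neighbours\<close>

definition neighbours :: "('a, 'b) pre_digraph \<Rightarrow> 'a \<Rightarrow> 'a set" where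
  "neighbours G u = {w. u \<rightarrow>\<^bsub>G\<^esub> w}"

text \<open>Known in spectral graph theory as the 2-degree of \<open>u\<close>.\<close>

definition neighbour_degree_sum :: "('a, 'b) pre_digraph \<Rightarrow> 'a \<Rightarrow> nat" where
  "neighbour_degree_sum G u = (\<Sum>w\<in>neighbours G u. out_degree G w)"

context graph
begin

section \<open>Neighbour sets, completeness and the edge count\<close>

lemma neighbours_subset: "neighbours G u \<subseteq> verts G - {u}"
  using adj_in_verts adj_not_same by (auto simp: neighbours_def)

lemma finite_neighbours [simp]: "finite (neighbours G u)"
  by (rule finite_subset[OF neighbours_subset]) simp

lemma neighbours_sym: "w \<in> neighbours G u \<longleftrightarrow> u \<in> neighbours G w"
  using graph_symmetric by (auto simp: neighbours_def)

lemma card_neighbours: "card (neighbours G u) = out_degree G u"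
proof -
  have "neighbours G u = head G ` out_arcs G u"
    by (auto simp: neighbours_def out_arcs_def arcs_ends_conv)
  moreover have "inj_on (head G) (out_arcs G u)"
    by (rule inj_onI) (auto simp: out_arcs_def arc_to_ends_def intro: no_multi_arcs)
  ultimately show ?thesis by (simp add: out_degree_def card_image)
qed

lemma out_degree_le: "u \<in> verts G \<Longrightarrow> out_degree G u \<le> card (verts G) - 1"
  using card_mono[OF _ neighbours_subset[of u]] by (simp add: card_neighbours)

lemma neighbours_eq_all:
  assumes "u \<in> verts G" "out_degree G u = card (verts G) - 1"
  shows "neighbours G u = verts G - {u}"
  using assms neighbours_subset[of u] by (intro card_subset_eq) (auto simp: card_neighbours)

text \<open>Reduces the equality case to a statement about degrees.\<close>

lemma complete_digraph_iff_out_degree: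
  "complete_digraph (card (verts G)) G \<longleftrightarrow> (\<forall>u\<in>verts G. out_degree G u = card (verts G) - 1)"
  (is "?L \<longleftrightarrow> ?R")
proof
  assume ?L
  then have "neighbours G u = verts G - {u}" if "u \<in> verts G" for u
    using that by (auto simp: complete_digraph_def neighbours_def)
  then show ?R using card_neighbours by (metis card_Diff_singleton)
next
  assume R: ?R
  have "(u, w) \<in> arcs_ends G \<longleftrightarrow> u \<in> verts G \<and> w \<in> verts G \<and> u \<noteq> w" for u w
    using neighbours_eq_all[of u] R adj_in_verts(1)[of u w] by (auto simp: neighbours_def)
  then have "arcs_ends G = {(u, v). (u, v) \<in> verts G \<times> verts G \<and> u \<noteq> v}" by auto
  then show ?L using graph_axioms by (simp add: complete_digraph_def)
qed

text \<open>Handshake lemma: the out-degrees count the arcs, and each end point set comes from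
  exactly two arcs. Symmetry supplies the reverse arc, looplessness makes it different, and the
  absence of multiple arcs excludes a third.\<close>

lemma sum_out_degree: "(\<Sum>u\<in>verts G. out_degree G u) = 2 * num_edges G"
proof -
  let ?f = "\<lambda>e. {tail G e, head G e}"
  have "(\<Sum>u\<in>verts G. out_degree G u) = card (arcs G)"
  proof -
    have "arcs G = (\<Union>u\<in>verts G. out_arcs G u)" by auto
    then have "card (arcs G) = card (\<Union>u\<in>verts G. out_arcs G u)" by simp
    also have "\<dots> = (\<Sum>u\<in>verts G. out_degree G u)"
      unfolding out_degree_def by (rule card_UN_disjoint) auto
    finally show ?thesis ..
  qed
  also have "card (arcs G) = (\<Sum>S\<in>?f ` arcs G. card {e \<in> arcs G. ?f e = S})"
    unfolding card_eq_sum by (rule sum.image_gen) simp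
  also have "\<dots> = (\<Sum>S\<in>?f ` arcs G. 2)"
  proof (rule sum.cong[OF refl])
    fix S assume "S \<in> ?f ` arcs G"
    then obtain e where e: "e \<in> arcs G" "S = ?f e" by blast
    obtain e' where e': "e' \<in> arcs G" "tail G e' = head G e" "head G e' = tail G e"
      using sym_arcs e(1) unfolding symmetric_conv by metis
    have "e \<noteq> e'" using e' no_loops[OF e(1)] by auto
    moreover have "{x \<in> arcs G. ?f x = S} = {e, e'}"
      using e e' by (auto simp: doubleton_eq_iff arc_to_ends_def intro: no_multi_arcs)
    ultimately show "card {x \<in> arcs G. ?f x = S} = 2" by simp
  qed
  also have "\<dots> = 2 * num_edges G" by (simp add: num_edges_def)
  finally show ?thesis .
qed

text \<open>A walk from \<open>u\<close> to a second vertex starts with an arc. Positivity permits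
  the later divisions by degrees.\<close>

lemma out_degree_pos:
  assumes "Digraph_Component.connected G" "card (verts G) \<ge> 2" "u \<in> verts G"
  shows "out_degree G u > 0"
proof -
  have "\<not> verts G \<subseteq> {u}"
    using assms(2) card_mono[of "{u}" "verts G"] by auto
  then obtain w where w: "w \<in> verts G" "w \<noteq> u" by blast
  from symmetric_connected_imp_strongly_connected[OF sym_arcs assms(1)]
  have "u \<rightarrow>\<^sup>* w" using assms(3) w(1) by (auto simp: strongly_connected_def)
  then obtain x where "u \<rightarrow> x" using w(2) by (cases rule: converse_reachable_cases) auto
  then have "neighbours G u \<noteq> {}" by (auto simp: neighbours_def)
  then show ?thesis by (simp flip: card_neighbours add: card_gt_0_iff)
qed

text \<open>In the degree sum \<open>2 * m\<close>, the vertices outside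
  \<open>neighbours G u\<close> are \<open>u\<close>, contributing its degree, and those in
  \<open>R\<close>, contributing at least 1 each; together this is at least \<open>n - 1\<close>.
  Equality leaves no excess over 1 in \<open>R\<close>.\<close>

lemma neighbour_degree_sum_le:
  assumes u: "u \<in> verts G" and pos: "\<And>w. w \<in> verts G \<Longrightarrow> out_degree G w > 0"
  shows "neighbour_degree_sum G u + (card (verts G) - 1) \<le> 2 * num_edges G"
    and "\<lbrakk>neighbour_degree_sum G u + (card (verts G) - 1) = 2 * num_edges G;
          w \<in> verts G; w \<noteq> u; w \<notin> neighbours G u\<rbrakk> \<Longrightarrow> out_degree G w = 1"
proof -
  define R where "R = verts G - {u} - neighbours G u"
  have fin: "finite R" by (simp add: R_def)
  have "verts G = insert u (neighbours G u \<union> R)" and "u \<notin> neighbours G u \<union> R"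
    using neighbours_subset[of u] u by (auto simp: R_def)
  moreover have "neighbours G u \<inter> R = {}" by (auto simp: R_def)
  ultimately have split: "2 * num_edges G = out_degree G u + (neighbour_degree_sum G u + (\<Sum>w\<in>R. out_degree G w))"
    and card: "card (verts G) = Suc (out_degree G u + card R)"
    using fin sum_out_degree by (auto simp: sum.union_disjoint neighbour_degree_sum_def card_Un_disjoint card_neighbours)
  have sumR: "(\<Sum>w\<in>R. out_degree G w) = card R + (\<Sum>w\<in>R. out_degree G w - 1)"
  proof -
    have "(\<Sum>w\<in>R. out_degree G w) = (\<Sum>w\<in>R. 1 + (out_degree G w - 1))"
      using pos by (intro sum.cong) (force simp: R_def)+
    then show ?thesis by (simp only: sum.distrib) simp
  qed
  show "neighbour_degree_sum G u + (card (verts G) - 1) \<le> 2 * num_edges G"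
    using split card sumR by simp
  assume "neighbour_degree_sum G u + (card (verts G) - 1) = 2 * num_edges G"
    and w: "w \<in> verts G" "w \<noteq> u" "w \<notin> neighbours G u"
  then have "(\<Sum>w\<in>R. out_degree G w - 1) = 0" using split card sumR by linarith
  then have "out_degree G w - 1 = 0" using w fin by (auto simp: R_def)
  then show "out_degree G w = 1" using pos[OF w(1)] by simp
qed

lemma neighbour_degree_sum_le_max:
  assumes "\<And>w. w \<in> verts G \<Longrightarrow> out_degree G w \<le> D"
  shows "neighbour_degree_sum G u \<le> out_degree G u * D"
  unfolding neighbour_degree_sum_def
  using sum_bounded_above[of "neighbours G u" "out_degree G" D] assms neighbours_subset[of u]
  by (auto simp: card_neighbours)

text \<open>Combines the two upper bounds \<open>2 * m - (n - 1)\<close> and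
  \<open>d * (n - 1)\<close> on \<open>S\<close>. Apart from full degree, equality requires the
  first bound to be sharp and one particular edge count.\<close>

lemma degree_plus_average_neighbour_degree_le:
  fixes u :: 'a
  defines "n \<equiv> card (verts G)" and "m \<equiv> num_edges G"
    and "d \<equiv> real (out_degree G u)" and "S \<equiv> real (neighbour_degree_sum G u)"
  assumes u: "u \<in> verts G" and pos: "\<And>w. w \<in> verts G \<Longrightarrow> out_degree G w > 0" and n: "n \<ge> 2"
  shows "d + S / d \<le> 2 * real m / (real n - 1) + real n - 2"
    and "\<lbrakk>d + S / d = 2 * real m / (real n - 1) + real n - 2; out_degree G u \<noteq> n - 1\<rbrakk> \<Longrightarrow>
       2 * m = (n - 1) * (out_degree G u + 1) \<and> neighbour_degree_sum G u + (n - 1) = 2 * m"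
proof -
  define k where "k = real n - 1"
  have k: "k \<ge> 1" and kn: "real (n - 1) = k" using n by (auto simp: k_def)
  have d: "d \<ge> 1" using pos[OF u] by (simp add: d_def)
  have dk: "d \<le> k" using out_degree_le[OF u] kn by (simp add: d_def n_def flip: of_nat_le_iff)
  have S1: "S + k \<le> 2 * real m"
    using neighbour_degree_sum_le(1)[OF u pos] kn
    unfolding S_def m_def n_def by (simp flip: of_nat_add of_nat_mult)
  have S2: "S / d \<le> k"
  proof -
    have "S \<le> real (out_degree G u * (n - 1))"
      unfolding S_def of_nat_le_iff n_def by (rule neighbour_degree_sum_le_max) (rule out_degree_le)
    then have "S \<le> d * k" by (simp only: d_def of_nat_mult kn)
    then show ?thesis using d by (simp add: field_simps)
  qed
  let ?B = "2 * real m / k + k - 1"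
  have B: "2 * real m / (real n - 1) + real n - 2 = ?B" by (simp add: k_def)
  \<comment> \<open>The two factors in the numerator are the source of the two alternatives in the
    equality case.\<close>
  have key: "?B - (d + (2 * real m - k) / d) = (k - d) * (k * (d + 1) - 2 * real m) / (d * k)"
    using d k by (simp add: field_simps)
  have Sd: "S / d \<le> (2 * real m - k) / d" using S1 d by (intro divide_right_mono) auto
  have main: "d + S / d \<le> ?B \<and> (d + S / d = ?B \<longrightarrow> d = k \<or> (2 * real m = k * (d + 1) \<and> S + k = 2 * real m))"
    \<comment> \<open>For few edges \<open>S + k \<le> 2 * m\<close> suffices, for many edges the trivial \<open>S \<le> d * k\<close>.\<close>
  proof (cases "2 * real m \<le> k * (d + 1)")
    case True
    have "(k - d) * (k * (d + 1) - 2 * real m) / (d * k) \<ge> 0"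
      using True d k dk by (intro divide_nonneg_nonneg mult_nonneg_nonneg) auto
    note ge = this[folded key]
    moreover have "d = k \<or> (2 * real m = k * (d + 1) \<and> S + k = 2 * real m)" if eq: "d + S / d = ?B"
    proof -
      have "?B - (d + (2 * real m - k) / d) = 0" and "S / d = (2 * real m - k) / d"
        using eq ge Sd by linarith+
      with d k show ?thesis unfolding key by auto
    qed
    ultimately show ?thesis using Sd by auto
  next
    case False
    \<comment> \<open>With \<open>S / d \<le> k\<close> this gives a strict inequality, so the claim
      about equality is vacuous.\<close>
    then have "d + 1 < 2 * real m / k" using k by (simp add: field_simps)
    then show ?thesis using S2 by linarith
  qed
  then show "d + S / d \<le> 2 * real m / (real n - 1) + real n - 2" unfolding B by blast
  assume "d + S / d = 2 * real m / (real n - 1) + real n - 2" "out_degree G u \<noteq> n - 1"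
  moreover have "d \<noteq> k" using calculation(2) kn unfolding d_def by (metis of_nat_eq_iff)
  ultimately have "2 * real m = k * (d + 1)" "S + k = 2 * real m" using main unfolding B by auto
  then have "real (2 * m) = real ((n - 1) * (out_degree G u + 1))"
    "real (neighbour_degree_sum G u + (n - 1)) = real (2 * m)"
    unfolding of_nat_add of_nat_mult kn by (simp_all add: d_def S_def)
  then show "2 * m = (n - 1) * (out_degree G u + 1) \<and> neighbour_degree_sum G u + (n - 1) = 2 * m"
    unfolding of_nat_eq_iff by blast
qed

text \<open>
  The assumptions on \<open>D\<close> and \<open>\<delta>\<close> hold when Popoviciu's inequality is an equality for the degrees. They
  exclude stars, which also attain the bound on the largest eigenvalue.
\<close>

lemma extremal_vertex_full_degree:
  fixes u :: 'a and D \<delta> :: nat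
  defines "n \<equiv> card (verts G)" and "m \<equiv> num_edges G"
  assumes u: "u \<in> verts G" and pos: "\<And>w. w \<in> verts G \<Longrightarrow> out_degree G w > 0" and n: "n \<ge> 2"
    and eq: "real (out_degree G u) + real (neighbour_degree_sum G u) / real (out_degree G u)
               = 2 * real m / (real n - 1) + real n - 2"
    and deg: "\<And>w. w \<in> verts G \<Longrightarrow> out_degree G w = D \<or> out_degree G w = \<delta>"
    and \<delta>: "\<And>w. w \<in> verts G \<Longrightarrow> \<delta> \<le> out_degree G w" "\<delta> > 0"
    and D: "\<And>w. w \<in> verts G \<Longrightarrow> out_degree G w \<le> D"
    and avg: "4 * m = n * (D + \<delta>)"
  shows "out_degree G u = n - 1"
proof (rule ccontr)
  assume neq: "out_degree G u \<noteq> n - 1"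
  define d where "d = out_degree G u"
  have d1: "d \<ge> 1" using pos[OF u] by (simp add: d_def)
  have dn: "d < n - 1" using neq out_degree_le[OF u] by (simp add: n_def d_def)
  have n3: "n > 2" using dn d1 by simp
  from degree_plus_average_neighbour_degree_le(2)[OF u pos, folded n_def m_def] n eq neq
  have m: "2 * m = (n - 1) * (d + 1)" and S: "neighbour_degree_sum G u + (n - 1) = 2 * m"
    by (auto simp: d_def)
  have "neighbours G u \<noteq> verts G - {u}"
  proof
    assume "neighbours G u = verts G - {u}"
    then have "out_degree G u = n - 1"
      using u by (simp add: n_def flip: card_neighbours)
    with neq show False ..
  qed
  \<comment> \<open>A nonneighbour of \<open>u\<close> has degree 1 by sharpness of the bound on the
    neighbour sum, which pins down \<delta>.\<close>
  then obtain w where w: "w \<in> verts G" "w \<noteq> u" "w \<notin> neighbours G u"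
    using neighbours_subset[of u] by blast
  have "out_degree G w = 1"
    using neighbour_degree_sum_le(2)[OF u pos _ w] S by (simp add: n_def m_def)
  then have \<delta>1: "\<delta> = 1" using \<delta>(1)[OF w(1)] \<delta>(2) by simp
  have avg': "2 * ((n - 1) * (d + 1)) = n * (D + 1)" using avg m \<delta>1 by simp
  from deg[OF u] show False
  proof
    assume "out_degree G u = D"
    \<comment> \<open>Cancelling \<open>d + 1\<close> gives \<open>n = 2\<close>, but
      \<open>1 \<le> d < n - 1\<close>.\<close>
    then have "2 * (n - 1) * (d + 1) = n * (d + 1)" using avg' by (simp add: d_def)
    then have "2 * (n - 1) = n" by (metis Suc_eq_plus1 mult_cancel2 nat.distinct(1))
    with n3 show False by simp
  next
    assume "out_degree G u = \<delta>"
    \<comment> \<open>Now \<open>2 * m = 2 * (n - 1)\<close>, so the neighbour sum is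
      \<open>n - 1\<close> and at most \<open>D\<close>. The average condition then yields
      \<open>n * n \<le> 4 * (n - 1)\<close>, that is
      \<open>(n - 2)\<^sup>2 \<le> 0\<close>.\<close>
    then have d: "d = 1" by (simp add: d_def \<delta>1)
    have "neighbour_degree_sum G u \<le> d * D"
      unfolding d_def by (rule neighbour_degree_sum_le_max) (rule D)
    then have "n \<le> D + 1" using S m d by simp
    then have "n * n \<le> 4 * (n - 1)" using avg' d mult_le_mono2[of n "D + 1" n] by simp
    then have "int n * int n \<le> 4 * (int n - 1)" using n by (simp add: of_nat_diff flip: of_nat_mult)
    then have "(int n - 2)\<^sup>2 \<le> 0" by (simp add: power2_eq_square algebra_simps)
    then show False using n3 by simp
  qed
qed

text \<open>
  This is the row sum bound for the matrix similar to \<open>Q\<close> by the diagonal matrix of degrees: the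
  rescaled eigenvector \<open>x u / d u\<close> is examined at an entry of largest absolute value. In the case of
  equality all neighbours of that entry are again of largest absolute value.
\<close>

lemma eigenfunction_bound:
  fixes x :: "'a \<Rightarrow> real" and q B :: real
  assumes pos: "\<And>w. w \<in> verts G \<Longrightarrow> out_degree G w > 0"
    and x: "u0 \<in> verts G" "x u0 \<noteq> 0"
    and eig: "\<And>u. u \<in> verts G \<Longrightarrow> real (out_degree G u) * x u + (\<Sum>w\<in>neighbours G u. x w) = q * x u"
    and B: "\<And>u. u \<in> verts G \<Longrightarrow>
      real (out_degree G u) + real (neighbour_degree_sum G u) / real (out_degree G u) \<le> B"
  obtains u where "u \<in> verts G" "q \<le> B"
    "\<And>w. \<lbrakk>q = B; w \<in> insert u (neighbours G u)\<rbrakk> \<Longrightarrow>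
      real (out_degree G w) + real (neighbour_degree_sum G w) / real (out_degree G w) = B"
proof -
  define d where "d = (\<lambda>u. real (out_degree G u))"
  define S where "S = (\<lambda>u. real (neighbour_degree_sum G u))"
  define y where "y = (\<lambda>u. \<bar>x u\<bar> / d u)"
  have d: "d u > 0" if "u \<in> verts G" for u using pos[OF that] by (simp add: d_def)
  have S: "S u = (\<Sum>w\<in>neighbours G u. d w)" for u
    by (simp add: S_def d_def neighbour_degree_sum_def)
  define Y where "Y = Max (y ` verts G)"
  have le: "y w \<le> Y" if "w \<in> verts G" for w using that by (simp add: Y_def)
  have "Y \<in> y ` verts G" unfolding Y_def using x by (intro Max_in) auto
  then obtain u where u: "u \<in> verts G" "y u = Y" by auto
  have Y: "Y > 0" using le[OF x(1)] d[OF x(1)] x by (auto simp: y_def intro: less_le_trans[rotated])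
  have ax: "\<bar>x w\<bar> = d w * y w" if "w \<in> verts G" for w using d[OF that] by (simp add: y_def)
  \<comment> \<open>The eigenvalue equation at a maximal entry, in absolute values and with
    \<open>\<bar>x z\<bar>\<close> written as \<open>d z * y z\<close>.\<close>
  have row: "q * (d w * Y) \<le> d w * (d w * Y) + (\<Sum>z\<in>neighbours G w. d z * y z)"
    if w: "w \<in> verts G" "y w = Y" for w
  proof -
    have "q * \<bar>x w\<bar> \<le> \<bar>q * x w\<bar>" by (simp add: abs_mult mult_right_mono)
    also have "\<dots> \<le> \<bar>d w * x w\<bar> + \<bar>\<Sum>z\<in>neighbours G w. x z\<bar>"
      using eig[OF w(1)] unfolding d_def by linarith
    also have "\<dots> \<le> d w * \<bar>x w\<bar> + (\<Sum>z\<in>neighbours G w. \<bar>x z\<bar>)"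
      using d[OF w(1)] by (simp add: abs_mult)
    also have "(\<Sum>z\<in>neighbours G w. \<bar>x z\<bar>) = (\<Sum>z\<in>neighbours G w. d z * y z)"
      using neighbours_subset[of w] by (intro sum.cong) (auto simp: ax)
    finally show ?thesis by (simp add: ax[OF w(1)] w(2))
  qed
  have sum_le: "(\<Sum>z\<in>neighbours G w. d z * y z) \<le> S w * Y" for w
    unfolding S sum_distrib_right using neighbours_subset[of w] d le
    by (intro sum_mono mult_left_mono) (auto intro: less_imp_le)
  have B': "d w * d w + S w \<le> B * d w" if "w \<in> verts G" for w
    using B[OF that] d[OF that] by (simp add: d_def S_def field_simps)
  \<comment> \<open>Stated for every maximising vertex, since in the case of equality it is applied
    to the neighbours of \<open>u\<close> too.\<close>
  have qB: "q \<le> B \<and> (q = B \<longrightarrow> d w + S w / d w = B)" if w: "w \<in> verts G" "y w = Y" for w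
  proof -
    have "(q * d w) * Y \<le> (d w * d w + S w) * Y"
      using row[OF w] sum_le[of w] by (simp add: algebra_simps)
    then have "q * d w \<le> d w * d w + S w" using Y by (simp only: mult_le_cancel_right_pos)
    then have "q \<le> d w + S w / d w" using d[OF w(1)] by (simp add: field_simps)
    then show ?thesis using B[OF w(1)] by (auto simp: d_def S_def)
  qed
  have "y w = Y" if q: "q = B" and w: "w \<in> neighbours G u" for w
  proof (rule ccontr)
    assume "y w \<noteq> Y"
    \<comment> \<open>A single neighbour below the maximum makes the row estimate strict, which
      contradicts \<open>q = B\<close>.\<close>
    then have "d w * y w < d w * Y"
      using le d w neighbours_subset[of u] by (intro mult_strict_left_mono) (force simp: less_le)+
    then have "(\<Sum>z\<in>neighbours G u. d z * y z) < S u * Y"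
      unfolding S sum_distrib_right using neighbours_subset[of u] d[THEN less_imp_le] le w
      by (intro sum_strict_mono_ex1 bexI[of _ w]) (auto intro!: mult_left_mono)
    then have "(q * d u) * Y < (d u * d u + S u) * Y"
      using row[OF u] by (simp add: algebra_simps)
    then have "q * d u < d u * d u + S u" using Y by (simp only: mult_less_cancel_right_pos)
    with B'[OF u(1)] q show False by simp
  qed
  then have "d w + S w / d w = B" if "q = B" "w \<in> insert u (neighbours G u)" for w
    using that qB[of w] u neighbours_subset[of u] by auto
  then show ?thesis using that[of u] u qB[OF u] by (auto simp: d_def S_def)
qed

end

section \<open>The signless Laplacian spectrum\<close>

context graph
begin

lemma out_degree_between:
  assumes "u \<in> verts G"
  shows "min_degree G \<le> out_degree G u" "out_degree G u \<le> max_degree G"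
  using assms by (auto simp: min_degree_def max_degree_def)

context
  fixes v :: "nat \<Rightarrow> 'a" and n :: nat
  assumes n: "n = card (verts G)" and bij: "bij_betw v {..<n} (verts G)"
begin

lemma signless_laplacian_mat_carrier: "signless_laplacian_mat G v \<in> carrier_mat n n"
  by (simp add: signless_laplacian_mat_def degree_mat_def adjacency_mat_def n)

text \<open>Comparing vertices instead of indices prepares the reindexing of row sums along
  \<open>bij\<close>.\<close>

lemma signless_laplacian_mat_index:
  assumes "i < n" "j < n"
  shows "signless_laplacian_mat G v $$ (i, j) =
    (if v j = v i then real (out_degree G (v i)) else if v j \<in> neighbours G (v i) then 1 else 0)"
proof -
  have "v j = v i \<longleftrightarrow> i = j"
    using assms bij by (auto simp: bij_betw_def inj_on_def)
  then show ?thesis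
    using assms adj_not_same[of "v i"]
    by (auto simp: neighbours_def signless_laplacian_mat_def degree_mat_def adjacency_mat_def n)
qed

text \<open>Serves two purposes: the identity as \<open>F\<close> gives the eigenvalue equation, the
  square with \<open>g = 1\<close> gives the squared entries of a row. The condition
  \<open>F 0 = 0\<close> removes the nonneighbours.\<close>

lemma signless_laplacian_mat_row_sum:
  fixes F :: "real \<Rightarrow> real" and g :: "'a \<Rightarrow> real"
  assumes i: "i < n" and F: "F 0 = 0"
  shows "(\<Sum>j<n. F (signless_laplacian_mat G v $$ (i, j)) * g (v j))
    = F (real (out_degree G (v i))) * g (v i) + F 1 * (\<Sum>w\<in>neighbours G (v i). g w)"
proof -
  let ?u = "v i"
  let ?h = "\<lambda>w. F (if w = ?u then real (out_degree G ?u) else if w \<in> neighbours G ?u then 1 else 0) * g w"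
  have u: "?u \<in> verts G" using bij i by (auto simp: bij_betw_def)
  have "(\<Sum>j<n. F (signless_laplacian_mat G v $$ (i, j)) * g (v j)) = (\<Sum>j<n. ?h (v j))"
    using i by (intro sum.cong) (auto simp: signless_laplacian_mat_index)
  also have "\<dots> = (\<Sum>w\<in>verts G. ?h w)"
    by (rule sum.reindex_bij_betw[OF bij])
  also have "\<dots> = ?h ?u + (\<Sum>w\<in>verts G - {?u}. ?h w)"
    using u by (simp add: sum.remove)
  also have "(\<Sum>w\<in>verts G - {?u}. ?h w) = (\<Sum>w\<in>neighbours G ?u. F 1 * g w)"
    using neighbours_subset[of ?u] F by (intro sum.mono_neutral_cong_right) auto
  finally show ?thesis by (simp add: sum_distrib_left)
qed

lemma signless_laplacian_mat_sym:
  assumes "i < n" "j < n"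
  shows "signless_laplacian_mat G v $$ (i, j) = signless_laplacian_mat G v $$ (j, i)"
  using assms neighbours_sym[of "v i" "v j"] by (auto simp: signless_laplacian_mat_index)

section \<open>Power sums of the spectrum, and eigenvectors as functions on vertices\<close>

lemma size_signless_laplacian_eigenvalues: "size (signless_laplacian_eigenvalues G v) = n"
  unfolding signless_laplacian_eigenvalues_def
  by (rule symmetric_real_mat_proots_char_poly(1)[OF signless_laplacian_mat_carrier signless_laplacian_mat_sym])

lemma sum_signless_laplacian_eigenvalues:
  "(\<Sum>e\<in>#signless_laplacian_eigenvalues G v. e) = 2 * real (num_edges G)"
proof -
  have "(\<Sum>e\<in>#signless_laplacian_eigenvalues G v. e) = (\<Sum>i<n. real (out_degree G (v i)))"
    unfolding signless_laplacian_eigenvalues_def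
    by (subst symmetric_real_mat_proots_char_poly(2)[OF signless_laplacian_mat_carrier signless_laplacian_mat_sym])
      (auto simp: signless_laplacian_mat_index)
  also have "\<dots> = (\<Sum>u\<in>verts G. real (out_degree G u))"
    by (rule sum.reindex_bij_betw[OF bij])
  also have "\<dots> = 2 * real (num_edges G)"
    using sum_out_degree by (simp flip: of_nat_sum)
  finally show ?thesis .
qed

lemma sum_square_signless_laplacian_eigenvalues:
  "(\<Sum>e\<in>#signless_laplacian_eigenvalues G v. e\<^sup>2)
    = (\<Sum>u\<in>verts G. (real (out_degree G u))\<^sup>2) + 2 * real (num_edges G)"
proof -
  have "(\<Sum>e\<in>#signless_laplacian_eigenvalues G v. e\<^sup>2)
      = (\<Sum>i<n. \<Sum>j<n. (signless_laplacian_mat G v $$ (i, j))\<^sup>2)"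
    unfolding signless_laplacian_eigenvalues_def
    by (rule symmetric_real_mat_proots_char_poly(3)[OF signless_laplacian_mat_carrier signless_laplacian_mat_sym])
  also have "\<dots> = (\<Sum>i<n. (real (out_degree G (v i)))\<^sup>2 + real (out_degree G (v i)))"
    using signless_laplacian_mat_row_sum[where F = "\<lambda>t. t\<^sup>2" and g = "\<lambda>_. 1"]
    by (intro sum.cong) (auto simp: card_neighbours)
  also have "\<dots> = (\<Sum>u\<in>verts G. (real (out_degree G u))\<^sup>2 + real (out_degree G u))"
    by (rule sum.reindex_bij_betw[OF bij])
  also have "\<dots> = (\<Sum>u\<in>verts G. (real (out_degree G u))\<^sup>2) + 2 * real (num_edges G)"
    using sum_out_degree by (simp add: sum.distrib flip: of_nat_sum)
  finally show ?thesis .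
qed

lemma signless_laplacian_eigenfunction:
  assumes e: "e \<in># signless_laplacian_eigenvalues G v"
  obtains x :: "'a \<Rightarrow> real" and u where "u \<in> verts G" "x u \<noteq> 0"
    "\<And>u. u \<in> verts G \<Longrightarrow> real (out_degree G u) * x u + (\<Sum>w\<in>neighbours G u. x w) = e * x u"
proof -
  let ?Q = "signless_laplacian_mat G v"
  note Q = signless_laplacian_mat_carrier
  have "char_poly ?Q \<noteq> 0" using degree_monic_char_poly[OF Q] by auto
  then have "poly (char_poly ?Q) e = 0" using e by (simp add: signless_laplacian_eigenvalues_def)
  then obtain y where y: "y \<in> carrier_vec n" "y \<noteq> 0\<^sub>v n" "?Q *\<^sub>v y = e \<cdot>\<^sub>v y"
    using Q by (auto simp: eigenvalue_def eigenvector_def simp flip: eigenvalue_root_char_poly[OF Q])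
  define x where "x = (\<lambda>u. y $ inv_into {..<n} v u)"
  have xv: "x (v i) = y $ i" if "i < n" for i
    using that bij by (simp add: x_def bij_betw_def inv_into_f_f)
  have "\<exists>i<n. y $ i \<noteq> 0"
  proof (rule ccontr)
    assume "\<not> (\<exists>i<n. y $ i \<noteq> 0)"
    then have "y = 0\<^sub>v n" using y(1) by (intro eq_vecI) auto
    with y(2) show False ..
  qed
  then obtain i where "i < n" "x (v i) \<noteq> 0" using xv by auto
  moreover from this have "v i \<in> verts G" using bij by (auto simp: bij_betw_def)
  moreover have "real (out_degree G u) * x u + (\<Sum>w\<in>neighbours G u. x w) = e * x u"
    if u: "u \<in> verts G" for u
  proof -
    obtain i where i: "i < n" "u = v i" using u bij by (auto simp: bij_betw_def)
    have "e * x u = (?Q *\<^sub>v y) $ i" using i y by (simp add: xv)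
    also have "\<dots> = (\<Sum>j<n. ?Q $$ (i, j) * y $ j)" by (rule index_mult_mat_vec_sum[OF Q y(1) i(1)])
    also have "\<dots> = (\<Sum>j<n. ?Q $$ (i, j) * x (v j))" by (simp add: xv)
    also have "\<dots> = real (out_degree G u) * x u + (\<Sum>w\<in>neighbours G u. x w)"
      using signless_laplacian_mat_row_sum[OF i(1), of "\<lambda>t. t" x] i(2) by simp
    finally show ?thesis ..
  qed
  ultimately show ?thesis using that by blast
qed

text \<open>With \<open>s\<close> the sum of an eigenfunction, each row reads
  \<open>s = (e - (n - 2)) * x w\<close>. If \<open>s = 0\<close>, a nonzero entry gives
  \<open>e = n - 2\<close>; otherwise summing over all vertices gives
  \<open>n = e - (n - 2)\<close>.\<close>

lemma complete_signless_laplacian_eigenvalue: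
  assumes complete: "\<And>u. u \<in> verts G \<Longrightarrow> out_degree G u = n - 1"
    and e: "e \<in># signless_laplacian_eigenvalues G v"
  shows "e = real n - 2 \<or> e = 2 * real n - 2"
proof -
  from e obtain x u where u: "u \<in> verts G" "x u \<noteq> 0"
    and eig: "\<And>u. u \<in> verts G \<Longrightarrow> real (out_degree G u) * x u + (\<Sum>w\<in>neighbours G u. x w) = e * x u"
    by (rule signless_laplacian_eigenfunction) blast
  define s where "s = (\<Sum>w\<in>verts G. x w)"
  have "n > 0" using u(1) by (auto simp: n card_gt_0_iff)
  then have n1: "real (n - 1) = real n - 1" by simp
  have s: "s = (e - (real n - 2)) * x w" if w: "w \<in> verts G" for w
  proof -
    have "neighbours G w = verts G - {w}" using neighbours_eq_all[OF w] complete[OF w] n by simp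
    then have "(\<Sum>z\<in>neighbours G w. x z) = s - x w" using w by (simp add: s_def sum_diff1)
    then show ?thesis using eig[OF w] complete[OF w] n1 by (simp add: algebra_simps)
  qed
  show ?thesis
  proof (cases "s = 0")
    case True
    then show ?thesis using s[OF u(1)] u(2) by simp
  next
    case False
    have "real n * s = (\<Sum>w\<in>verts G. s)" by (simp add: n)
    also have "\<dots> = (\<Sum>w\<in>verts G. (e - (real n - 2)) * x w)" by (intro sum.cong refl s)
    also have "\<dots> = (e - (real n - 2)) * s" by (simp add: s_def sum_distrib_left)
    finally show ?thesis using False by simp
  qed
qed

end
end

section \<open>The bound on the energy\<close>

theorem theorem7:
  fixes G :: "('a, 'b) pre_digraph" and v :: "nat \<Rightarrow> 'a" and n m :: nat and QE q bound :: real
  assumes "graph G"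
    and "Digraph_Component.connected G"
    and "card (verts G) = n"
    and "n \<ge> 2"
    and "num_edges G = m"
    and "bij_betw v {0..<n} (verts G)"
    and "QE = signless_laplacian_energy G v"
    and "q = largest_signless_laplacian_eigenvalue G v"
    and "bound = 2 * real m / (real n * (real n - 1)) + real n - 2
           + sqrt ((real n - 1) * (2 * real m
               + real n / 4 * (real (max_degree G) - real (min_degree G))\<^sup>2
               - (q - 2 * real m / real n)\<^sup>2))"
  shows "QE \<le> bound \<and> (QE = bound \<longleftrightarrow> complete_digraph n G)"
proof -
  interpret graph G by fact
  note n = assms(3)[symmetric] and m = assms(5)
  have n2: "real n \<ge> 2" using \<open>n \<ge> 2\<close> by simp
  have bij: "bij_betw v {..<n} (verts G)" using assms(6) by (simp add: atLeast0LessThan)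
  have pos: "out_degree G w > 0" if "w \<in> verts G" for w
    using out_degree_pos[OF assms(2) _ that] assms(3,4) by simp
  have ne: "verts G \<noteq> {}" using assms(3,4) by auto
  define E where "E = signless_laplacian_eigenvalues G v"
  define c where "c = 2 * real m / real n"
  define f where "f = (\<lambda>u. real (out_degree G u))"
  define D \<delta> where "D = real (max_degree G)" and "\<delta> = real (min_degree G)"
  define B where "B = 2 * real m / (real n - 1) + real n - 2"
  note size = size_signless_laplacian_eigenvalues[OF n bij, folded E_def]
    and sum1 = sum_signless_laplacian_eigenvalues[OF n bij, folded E_def, unfolded m]
    and sum2 = sum_square_signless_laplacian_eigenvalues[OF n bij, folded E_def, unfolded m]
  have f: "(\<Sum>u\<in>verts G. f u) = 2 * real m"
    using sum_out_degree m by (simp add: f_def flip: of_nat_sum)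
  have between: "\<delta> \<le> f u" "f u \<le> D" if "u \<in> verts G" for u
    using out_degree_between[OF that] by (simp_all add: f_def D_def \<delta>_def)

  have "E \<noteq> {#}" using size assms(4) by auto
  then have qE: "q \<in># E" and qmax: "\<And>e. e \<in># E \<Longrightarrow> e \<le> q"
    using Max_in[of "set_mset E"] Max_ge[of "set_mset E"] unfolding assms(8)
    by (auto simp: largest_signless_laplacian_eigenvalue_def E_def)
  then obtain R where R: "E = add_mset q R" by (metis mset_add)
  have size_R: "real (size R) = real n - 1" using size by (auto simp: R)
  \<comment> \<open>The largest eigenvalue is at least the mean \<open>c\<close>, so its term in the
    energy is \<open>q - c\<close>.\<close>
  have cq: "c \<le> q"
  proof -
    have "2 * real m \<le> (\<Sum>e\<in>#E. q)" unfolding sum1[symmetric] by (rule sum_mset_mono) (rule qmax)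
    then show ?thesis using n2 by (simp add: c_def size field_simps)
  qed

  \<comment> \<open>\<open>V\<close> is the sum of the squared deviations of the degrees from
    \<open>c\<close>, in expanded form, and \<open>P\<close> is its Popoviciu bound.\<close>
  define V where "V = (\<Sum>u\<in>verts G. (f u)\<^sup>2) - (2 * real m)\<^sup>2 / real n"
  define P where "P = real n / 4 * (D - \<delta>)\<^sup>2"
  have defect: "P - V = real n * (c - (D + \<delta>) / 2)\<^sup>2 + (\<Sum>x\<in>verts G. (D - f x) * (f x - \<delta>))"
    using popoviciu_defect[OF finite_verts ne, of D \<delta> f] unfolding f n[symmetric] V_def P_def c_def .
  have defect_nonneg: "(D - f u) * (f u - \<delta>) \<ge> 0" if "u \<in> verts G" for u
    using between[OF that] by simp
  have sq_nonneg: "real n * (c - (D + \<delta>) / 2)\<^sup>2 \<ge> 0" by simp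
  have sum_defect_nonneg: "(\<Sum>x\<in>verts G. (D - f x) * (f x - \<delta>)) \<ge> 0"
    by (rule sum_nonneg) (rule defect_nonneg)
  have VP: "V \<le> P" using defect sq_nonneg sum_defect_nonneg by linarith
  have var: "(\<Sum>e\<in>#E. (e - c)\<^sup>2) = 2 * real m + V"
  proof -
    have "(\<Sum>e\<in>#E. (e - c)\<^sup>2) = (\<Sum>e\<in>#E. e\<^sup>2 + (- 2 * c) * e + c\<^sup>2)"
      by (intro arg_cong[of _ _ sum_mset] image_mset_cong) (simp add: power2_eq_square algebra_simps)
    also have "\<dots> = (\<Sum>e\<in>#E. e\<^sup>2) + (- 2 * c) * (\<Sum>e\<in>#E. e) + real n * c\<^sup>2"
      by (simp only: sum_mset.distrib sum_mset_constant size flip: sum_mset_distrib_left)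
    also have "\<dots> = 2 * real m + V"
      using n2 unfolding sum1 sum2 by (simp add: V_def c_def f_def power2_eq_square field_simps)
    finally show ?thesis .
  qed
  define SR where "SR = (\<Sum>e\<in>#R. \<bar>e - c\<bar>)"
  have QE_sum: "QE = (\<Sum>e\<in>#E. \<bar>e - c\<bar>)"
    by (simp add: assms(7) signless_laplacian_energy_def m E_def c_def flip: n)
  then have QE: "QE = (q - c) + SR" using cq by (simp add: SR_def R)
  \<comment> \<open>Cauchy--Schwarz on the \<open>n - 1\<close> elements of \<open>R\<close>, whose
    squared deviations are those of \<open>E\<close> without that of \<open>q\<close>.\<close>
  have SR_le: "SR \<le> sqrt ((real n - 1) * (2 * real m + V - (q - c)\<^sup>2))"
  proof (rule real_le_rsqrt)
    have "(\<Sum>e\<in>#R. (e - c)\<^sup>2) = 2 * real m + V - (q - c)\<^sup>2" using var by (simp add: R)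
    then show "SR\<^sup>2 \<le> (real n - 1) * (2 * real m + V - (q - c)\<^sup>2)"
      using sum_mset_abs_square_le[of "\<lambda>e. e - c" R] by (simp add: SR_def size_R)
  qed
  have V_mono: "sqrt ((real n - 1) * (2 * real m + V - (q - c)\<^sup>2))
      \<le> sqrt ((real n - 1) * (2 * real m + P - (q - c)\<^sup>2))"
    using VP n2 by (intro real_sqrt_le_mono mult_left_mono) auto
  have bound: "bound = (B - c) + sqrt ((real n - 1) * (2 * real m + P - (q - c)\<^sup>2))"
  proof -
    \<comment> \<open>Partial fractions split the first term into
      \<open>2 * m / (n - 1) - 2 * m / n\<close>.\<close>
    have "2 * real m / (real n * (real n - 1)) + real n - 2 = B - c"
      using n2 by (simp add: B_def c_def field_simps)
    then show ?thesis unfolding assms(9) by (simp add: P_def D_def \<delta>_def c_def)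
  qed

  obtain x u0 where x: "u0 \<in> verts G" "x u0 \<noteq> 0"
    "\<And>u. u \<in> verts G \<Longrightarrow> real (out_degree G u) * x u + (\<Sum>w\<in>neighbours G u. x w) = q * x u"
    using signless_laplacian_eigenfunction[OF n bij qE[unfolded E_def]] by metis
  have row_le: "real (out_degree G u) + real (neighbour_degree_sum G u) / real (out_degree G u) \<le> B"
    if "u \<in> verts G" for u
    using degree_plus_average_neighbour_degree_le(1)[OF that pos] assms(3-5) by (simp add: B_def)
  obtain u where u: "u \<in> verts G" and qB: "q \<le> B"
    and tight: "\<And>w. \<lbrakk>q = B; w \<in> insert u (neighbours G u)\<rbrakk> \<Longrightarrow>
      real (out_degree G w) + real (neighbour_degree_sum G w) / real (out_degree G w) = B"
    using eigenfunction_bound[where x = x and q = q and B = B, OF pos x row_le] by blast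

  \<comment> \<open>The same \<open>q\<close> stands under both roots, so \<open>q \<le> B\<close>
    enters only through the term outside them.\<close>
  have le: "QE \<le> bound" using QE bound SR_le V_mono qB by linarith
  have "complete_digraph n G" if "QE = bound"
  proof -
    \<comment> \<open>Every estimate in the chain must be sharp; the equal roots give
      \<open>P = V\<close>, and then both nonnegative parts of the defect vanish.\<close>
    have "q = B" and sqrt_eq: "sqrt ((real n - 1) * (2 * real m + V - (q - c)\<^sup>2))
      = sqrt ((real n - 1) * (2 * real m + P - (q - c)\<^sup>2))"
      using that QE bound SR_le V_mono qB by linarith+
    then have "P - V = 0" using n2 by simp
    then have avg: "real n * (c - (D + \<delta>) / 2)\<^sup>2 = 0"
      and zero: "(\<Sum>x\<in>verts G. (D - f x) * (f x - \<delta>)) = 0"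
      using defect sq_nonneg sum_defect_nonneg by linarith+
    from avg have "c = (D + \<delta>) / 2" using n2 by simp
    then have "real (4 * m) = real (n * (max_degree G + min_degree G))"
      using n2 by (simp add: c_def D_def \<delta>_def field_simps)
    then have avg': "4 * m = n * (max_degree G + min_degree G)" unfolding of_nat_eq_iff .
    have ext: "out_degree G w = max_degree G \<or> out_degree G w = min_degree G" if "w \<in> verts G" for w
      using zero that defect_nonneg by (auto simp: sum_nonneg_eq_0_iff f_def D_def \<delta>_def)
    have min_pos: "min_degree G > 0"
      using Min_in[of "out_degree G ` verts G"] ne pos by (auto simp: min_degree_def)
    have full: "out_degree G w = n - 1" if "w \<in> insert u (neighbours G u)" for w
    proof -
      have w: "w \<in> verts G" using that u neighbours_subset[of u] by auto
      show ?thesis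
        using extremal_vertex_full_degree[OF w pos, where D = "max_degree G" and \<delta> = "min_degree G"]
          tight[OF \<open>q = B\<close> that] ext out_degree_between min_pos avg' assms(3-5)
        by (simp add: B_def)
    qed
    \<comment> \<open>As \<open>u\<close> has full degree, \<open>full\<close> already covers every
      vertex.\<close>
    have "neighbours G u = verts G - {u}"
      using neighbours_eq_all[OF u] full[of u] assms(3) by simp
    then have "\<forall>w\<in>verts G. out_degree G w = n - 1" using full by auto
    then show ?thesis using complete_digraph_iff_out_degree assms(3) by simp
  qed
  moreover have "QE = bound" if "complete_digraph n G"
  proof -
    have deg: "out_degree G w = n - 1" if "w \<in> verts G" for w
      using \<open>complete_digraph n G\<close> complete_digraph_iff_out_degree assms(3) that by simp
    have n1: "real (n - Suc 0) = real n - 1" using assms(4) by simp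
    have m2: "2 * real m = real n * (real n - 1)"
      using f by (simp add: f_def deg n1 flip: n)
    have "out_degree G ` verts G = {n - 1}" using deg ne by auto
    then have "P = 0" by (simp add: P_def D_def \<delta>_def max_degree_def min_degree_def)
    have c: "c = real n - 1" using m2 n2 by (simp add: c_def)
    have eig: "e = real n - 2 \<or> e = 2 * real n - 2" if "e \<in># E" for e
      using complete_signless_laplacian_eigenvalue[OF n bij deg] that by (simp add: E_def)
    \<comment> \<open>The alternative \<open>n - 2\<close> lies below the mean
      \<open>c = n - 1\<close>.\<close>
    have q: "q = 2 * real n - 2" using eig[OF qE] cq c by linarith
    \<comment> \<open>The only eigenvalues are \<open>n - 2\<close> and \<open>2 * n - 2\<close>, so the absolute value can be replaced by an
      affine function and multiplicities are not needed.\<close>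
    define \<alpha> where "\<alpha> = (real n - 2) / real n"
    \<comment> \<open>The line passes through \<open>(n - 2, 1)\<close> and
      \<open>(2 * n - 2, n - 1)\<close>, which determines its slope \<alpha>.\<close>
    have abs_eq: "\<bar>e - c\<bar> = (1 - \<alpha> * (real n - 2)) + \<alpha> * e" if "e \<in># E" for e
      using eig[OF that]
    proof
      assume "e = real n - 2"
      then show ?thesis by (simp add: c)
    next
      assume e: "e = 2 * real n - 2"
      have "\<alpha> * real n = real n - 2" using n2 by (simp add: \<alpha>_def)
      then show ?thesis using n2 unfolding e c by (simp add: algebra_simps)
    qed
    have "QE = (\<Sum>e\<in>#E. (1 - \<alpha> * (real n - 2)) + \<alpha> * e)"
      unfolding QE_sum by (intro arg_cong[of _ _ sum_mset] image_mset_cong abs_eq)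
    also have "\<dots> = real n * (1 - \<alpha> * (real n - 2)) + \<alpha> * (2 * real m)"
      by (simp only: sum_mset.distrib sum_mset_constant size sum1 flip: sum_mset_distrib_left)
    also have "\<dots> = 2 * real n - 2"
      unfolding m2 using n2 by (simp add: \<alpha>_def field_simps)
    finally have "QE = 2 * real n - 2" .
    moreover have "B = 2 * real n - 2" unfolding B_def m2 using n2 by simp
    moreover have "2 * real m + P - (q - c)\<^sup>2 = real n - 1"
      unfolding m2 \<open>P = 0\<close> q c by (simp add: power2_eq_square algebra_simps)
    ultimately show ?thesis using n2 unfolding bound c by simp
  qed
  ultimately show ?thesis using le by blast
qed

end
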